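(* The second moment of the one-parameter family $E: y^2=4x^3+(4m+1)x^2+n\cdot t x$ (with parameter $t$ and integers $m,n$) is $$A_{2,E}(p)=\begin{cases} p^2-3p & \text{if } p=4k+1,\\ p^2-p & \text{if } p=4k+3,\end{cases}$$ where $k$ denotes an integer.
   Context: Here $p$ is an odd prime and $\left(\frac{\cdot}{p}\right)$ denotes the Legendre symbol, with $\left(\frac{u}{p}\right)=0$ if $p\mid u$. For a family $y^2=f_t(x)$, with $f_t(x)$ a cubic polynomial in $x$ whose coefficients are integer polynomials in $t$, one sets $a_t(p):=p-\#\{(x,y)\in(\mathbb{Z}/p\mathbb{Z})^2: y^2\equiv f_t(x) \bmod p\}=-\sum_{x \bmod p}\left(\frac{f_t(x)}{p}\right)$. The second moment is taken here without averaging over $t$: $A_{2,E}(p):=\sum_{t \bmod p}a_t(p)^2$, the sum running over all residues $t$ modulo $p$.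
   Formalization: The formula is proved for odd primes p dividing neither n nor 4m+1; whenever p divides n or 4m+1 the stated formula is false (e.g. p=5, m=1, n=1 gives 40 instead of 10). *)

theory Defs
  imports "HOL-Number_Theory.Number_Theory" "HOL-Computational_Algebra.Polynomial"
begin

text \<open>
  A one-parameter family \<open>y\<^sup>2 = f\<^sub>t(x)\<close> is given by a polynomial in \<open>x\<close> (outer) whose
  coefficients are integer polynomials in \<open>t\<close> (inner); \<open>fibre F t\<close> is \<open>f\<^sub>t\<close>.
\<close>

definition fibre :: "int poly poly \<Rightarrow> int \<Rightarrow> int poly" where
  "fibre F t = map_poly (\<lambda>c. poly c t) F"

definition affine_points :: "int poly \<Rightarrow> int \<Rightarrow> (int \<times> int) set" where
  "affine_points f p =
     {(x, y). x \<in> {0..<p} \<and> y \<in> {0..<p} \<and> [y ^ 2 = poly f x] (mod p)}"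

definition trace_of_fibre :: "int poly poly \<Rightarrow> int \<Rightarrow> int \<Rightarrow> int" where
  "trace_of_fibre F t p = p - int (card (affine_points (fibre F t) p))"

text \<open>Not averaged: there is no factor \<open>1/p\<close>.\<close>

definition second_moment :: "int poly poly \<Rightarrow> int \<Rightarrow> int" where
  "second_moment F p = (\<Sum>t\<in>{0..<p}. (trace_of_fibre F t p) ^ 2)"

definition family_E :: "int \<Rightarrow> int \<Rightarrow> int poly poly" where
  "family_E m n = [: 0, [:0, n:], [:4 * m + 1:], [:4:] :]"

lemma poly_fibre_family_E:
  "poly (fibre (family_E m n) t) x = 4 * x ^ 3 + (4 * m + 1) * x ^ 2 + n * t * x"
  by (simp add: fibre_def family_E_def map_poly_pCons algebra_simps
      power2_eq_square power3_eq_cube)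

end

theory Submission
  imports Defs
begin

text \<open>
  Expand \<open>a\<^sub>t(p)\<^sup>2\<close> into a double sum over \<open>x\<close>, \<open>y\<close> and sum over \<open>t\<close> first: since
  \<open>f\<^sub>t(x) = x (4 x\<^sup>2 + c x + n t)\<close> with \<open>c = 4 m + 1\<close>, the inner sum is the correlation of
  the Legendre symbol with a shift of itself, which is \<open>p - 1\<close> if
  \<open>4 x\<^sup>2 + c x\<close> and \<open>4 y\<^sup>2 + c y\<close> agree modulo \<open>p\<close>, and \<open>- 1\<close> otherwise. They agree
  iff \<open>y = x\<close> or \<open>y = - x - c / 4\<close>, so only a sum of Legendre symbols of
  \<open>x\<^sup>2\<close> and \<open>- x (x + c / 4)\<close> remains, which is again a correlation.
\<close>

section \<open>Legendre symbols and sums over a residue system\<close>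

lemma Legendre_cong:
  assumes "[a = b] (mod p)"
  shows "Legendre a p = Legendre b p"
proof -
  have "[a = 0] (mod p) \<longleftrightarrow> [b = 0] (mod p)"
    using assms by (auto simp: cong_def)
  moreover have "QuadRes p a \<longleftrightarrow> QuadRes p b"
    unfolding QuadRes_def using assms by (auto simp: cong_def)
  ultimately show ?thesis
    by (simp add: Legendre_def)
qed

lemma Legendre_eq_0_iff: "Legendre a p = 0 \<longleftrightarrow> p dvd a"
  by (auto simp: Legendre_def cong_0_iff)

lemma Legendre_values: "Legendre a p \<in> {-1, 0, 1}"
  by (auto simp: Legendre_def)

lemma Legendre_square:
  "Legendre a p * Legendre a p = (if p dvd a then 0 else 1)"
  by (auto simp: Legendre_def cong_0_iff)

text \<open>For \<open>a\<close> invertible, \<open>x \<mapsto> a * x + b\<close> permutes the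
  residues; periodicity of \<open>g\<close> lets the sum ignore the reduction modulo
  \<open>p\<close>.\<close>

lemma sum_residues_affine:
  fixes g :: "int \<Rightarrow> 'a::comm_monoid_add"
  assumes "p > 0" and "coprime a p" and per: "\<And>x y. [x = y] (mod p) \<Longrightarrow> g x = g y"
  shows "(\<Sum>x\<in>{0..<p}. g (a * x + b)) = (\<Sum>x\<in>{0..<p}. g x)"
proof -
  let ?h = "\<lambda>x. (a * x + b) mod p"
  have inj: "inj_on ?h {0..<p}"
  proof (rule inj_onI)
    fix x y assume xy: "x \<in> {0..<p}" "y \<in> {0..<p}" and "?h x = ?h y"
    then have "[a * x = a * y] (mod p)"
      using cong_add_rcancel[of "a * x" b "a * y" p] by (simp add: cong_def)
    then have "[x = y] (mod p)"
      using assms(2) by (simp add: cong_mult_lcancel)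
    then show "x = y"
      using xy by (simp add: cong_def)
  qed
  have "?h ` {0..<p} = {0..<p}"
    using inj assms(1) by (intro endo_inj_surj) auto
  then have "(\<Sum>x\<in>{0..<p}. g x) = (\<Sum>x\<in>{0..<p}. g (?h x))"
    by (metis (no_types, lifting) inj sum.reindex_cong)
  also have "\<dots> = (\<Sum>x\<in>{0..<p}. g (a * x + b))"
    by (intro sum.cong refl per) (simp add: cong_def)
  finally show ?thesis by simp
qed

lemma sum_residues_delta:
  fixes g :: "int \<Rightarrow> 'a::semiring_1"
  assumes "p > 0" and per: "\<And>x y. [x = y] (mod p) \<Longrightarrow> g x = g y"
  shows "(\<Sum>x\<in>{0..<p}. g x * of_bool [x = z] (mod p)) = g z"
proof -
  have "(\<Sum>x\<in>{0..<p}. g x * of_bool [x = z] (mod p)) =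
      (\<Sum>x\<in>{0..<p}. if x = z mod p then g x else 0)"
    by (intro sum.cong) (auto simp: cong_def)
  also have "\<dots> = g (z mod p)"
    using assms(1) by simp
  also have "\<dots> = g z"
    by (intro per) (simp add: cong_def)
  finally show ?thesis .
qed

section \<open>The Legendre symbol modulo an odd prime\<close>

context
  fixes p :: int
  assumes prime_p: "prime p" and odd_p: "odd p"
begin

lemma p_gt_2: "p > 2"
  using prime_ge_2_int[OF prime_p] odd_p by (cases "p = 2") auto

lemma not_p_dvd_2: "\<not> p dvd 2"
  using p_gt_2 zdvd_not_zless[of 2 p] by simp

lemma coprime_p_iff: "coprime a p \<longleftrightarrow> \<not> p dvd a"
  using prime_imp_coprime[OF prime_p, of a] coprime_absorb_left[of p a] not_prime_unit[of p] prime_p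
  by (auto simp: coprime_commute)

text \<open>Since \<open>p > 2\<close>, the values -1, 0, 1 are pairwise incongruent. This turns the
  congruences given by Euler's criterion into equalities.\<close>

lemma Legendre_eqI:
  assumes "[a = b] (mod p)" and "a \<in> {-1, 0, 1}" and "b \<in> {-1, 0, 1::int}"
  shows "a = b"
  using assms p_gt_2 zdvd_not_zless[of 2 p] zdvd_not_zless[of 1 p]
  by (auto simp: cong_iff_dvd_diff)

lemma Legendre_euler: "[Legendre a p = a ^ nat ((p - 1) div 2)] (mod p)"
proof -
  obtain q where q: "p = int q"
    using p_gt_2 by (metis nonneg_int_cases less_le_not_le order_trans zero_le_numeral)
  then have "prime q" "2 < q"
    using prime_p p_gt_2 by auto
  moreover have "nat ((p - 1) div 2) = (q - 1) div 2"
    using q p_gt_2 by (simp add: nat_div_distrib nat_diff_distrib)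
  ultimately show ?thesis
    using euler_criterion[of q a] q by simp
qed

lemma Legendre_mult: "Legendre (a * b) p = Legendre a p * Legendre b p"
proof (rule Legendre_eqI)
  have "[Legendre a p * Legendre b p = (a * b) ^ nat ((p - 1) div 2)] (mod p)"
    unfolding power_mult_distrib by (intro cong_mult Legendre_euler)
  then show "[Legendre (a * b) p = Legendre a p * Legendre b p] (mod p)"
    using Legendre_euler cong_sym cong_trans by blast
  show "Legendre a p * Legendre b p \<in> {-1, 0, 1}"
    using Legendre_values[of a p] Legendre_values[of b p] by auto
qed (rule Legendre_values)

lemma Legendre_minus_1: "Legendre (-1) p = (-1) ^ nat ((p - 1) div 2)"
  using Legendre_euler[of "-1"] Legendre_values
  by (rule Legendre_eqI) (cases "even (nat ((p - 1) div 2))"; simp)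

text \<open>The roots are 0 alone, a pair \<open>z\<close>, \<open>- z\<close>, or none, matching
  the symbol values 0, 1, -1.\<close>

lemma card_square_roots:
  "int (card {y \<in> {0..<p}. [y\<^sup>2 = a] (mod p)}) = 1 + Legendre a p"
proof -
  let ?R = "{y \<in> {0..<p}. [y\<^sup>2 = a] (mod p)}"
  consider "p dvd a" | "\<not> p dvd a" "QuadRes p a" | "\<not> p dvd a" "\<not> QuadRes p a"
    by blast
  then show ?thesis
  proof cases
    case 1
    have "[y\<^sup>2 = a] (mod p) \<longleftrightarrow> p dvd y" for y
    proof -
      have "[y\<^sup>2 = a] (mod p) \<longleftrightarrow> [y\<^sup>2 = 0] (mod p)"
        using 1 by (simp add: cong_def dvd_eq_mod_eq_0)
      then show ?thesis
        using prime_p by (simp add: cong_0_iff prime_dvd_power_iff)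
    qed
    then have "?R = {0}"
      using p_gt_2 by (auto dest: zdvd_imp_le)
    then show ?thesis
      using 1 by (simp add: Legendre_eq_0_iff)
  next
    case 2
    then obtain z where z: "[z\<^sup>2 = a] (mod p)"
      by (auto simp: QuadRes_def)
    have ndvd: "\<not> p dvd z"
      using z 2(1) cong_dvd_iff[OF z] by (auto simp: power2_eq_square)
    have "[y\<^sup>2 = a] (mod p) \<longleftrightarrow> [y = z] (mod p) \<or> [y = - z] (mod p)" for y
    proof -
      have "[y\<^sup>2 = a] (mod p) \<longleftrightarrow> [y\<^sup>2 = z\<^sup>2] (mod p)"
        using z by (simp add: cong_def)
      also have "\<dots> \<longleftrightarrow> p dvd (y - z) * (y - (- z))"
        by (simp add: cong_iff_dvd_diff power2_eq_square algebra_simps)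
      finally show ?thesis
        using prime_p by (simp add: prime_dvd_mult_iff cong_iff_dvd_diff)
    qed
    then have "y \<in> ?R \<longleftrightarrow> y \<in> {0..<p} \<and> (y mod p = z mod p \<or> y mod p = (- z) mod p)" for y
      by (simp add: cong_def)
    moreover have "y \<in> {0..<p} \<and> y mod p = w mod p \<longleftrightarrow> y = w mod p" for y w
      using p_gt_2 by auto
    ultimately have "?R = {z mod p, (- z) mod p}"
      by blast
    moreover have "z mod p \<noteq> (- z) mod p"
    proof
      assume "z mod p = (- z) mod p"
      then have "p dvd 2 * z"
        by (simp add: mod_eq_dvd_iff)
      then show False
        using prime_p ndvd not_p_dvd_2 by (simp add: prime_dvd_mult_iff)
    qed
    ultimately show ?thesis
      using 2 by (simp add: Legendre_def cong_0_iff)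
  next
    case 3
    then have "?R = {}"
      by (auto simp: QuadRes_def)
    then have "card ?R = 0"
      by (simp only: card.empty)
    then show ?thesis
      using 3 by (simp add: Legendre_def cong_0_iff)
  qed
qed

section \<open>Traces of the fibres as character sums\<close>

lemma card_affine_points:
  "int (card (affine_points f p)) = p + (\<Sum>x\<in>{0..<p}. Legendre (poly f x) p)"
proof -
  have "affine_points f p =
      (SIGMA x:{0..<p}. {y \<in> {0..<p}. [y\<^sup>2 = poly f x] (mod p)})"
    by (auto simp: affine_points_def)
  then have "int (card (affine_points f p)) =
      (\<Sum>x\<in>{0..<p}. int (card {y \<in> {0..<p}. [y\<^sup>2 = poly f x] (mod p)}))"
    by (simp only: card_SigmaI finite_atLeastLessThan_int finite_Collect_conjI
        Collect_mem_eq simp_thms ball_triv ball_simps of_nat_sum)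
  also have "\<dots> = p + (\<Sum>x\<in>{0..<p}. Legendre (poly f x) p)"
    unfolding card_square_roots using p_gt_2 by (simp add: sum.distrib)
  finally show ?thesis .
qed

lemma trace_of_fibre_eq:
  "trace_of_fibre F t p = - (\<Sum>x\<in>{0..<p}. Legendre (poly (fibre F t) x) p)"
  by (simp add: trace_of_fibre_def card_affine_points)

section \<open>Complete sums and correlations of Legendre symbols\<close>

lemma sum_Legendre: "(\<Sum>x\<in>{0..<p}. Legendre x p) = 0"
proof -
  \<comment> \<open>The parabola \<open>y\<^sup>2 = x\<close> has exactly one point for each \<open>y\<close>.\<close>
  have "(\<Sum>x\<in>{0..<p}. 1 + Legendre x p) =
      (\<Sum>x\<in>{0..<p}. \<Sum>y\<in>{0..<p}. of_bool [x = y\<^sup>2] (mod p))"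
    unfolding card_square_roots[symmetric] by (simp add: Int_def cong_sym_eq)
  also have "\<dots> = (\<Sum>y\<in>{0..<p}. \<Sum>x\<in>{0..<p}. 1 * of_bool [x = y\<^sup>2] (mod p))"
    by (subst sum.swap) simp
  also have "\<dots> = p"
    using p_gt_2 by (subst sum_residues_delta) auto
  finally show ?thesis
    using p_gt_2 by (simp add: sum.distrib)
qed

lemma sum_Legendre_affine:
  assumes "\<not> p dvd a"
  shows "(\<Sum>x\<in>{0..<p}. Legendre (a * x + b) p) = 0"
  using assms p_gt_2 sum_residues_affine[of p a "\<lambda>x. Legendre x p" b]
  by (simp add: coprime_p_iff sum_Legendre Legendre_cong)

lemma sum_Legendre_square: "(\<Sum>x\<in>{0..<p}. Legendre x p * Legendre x p) = p - 1"
proof -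
  have "(\<Sum>x\<in>{0..<p}. Legendre x p * Legendre x p) = (\<Sum>x\<in>{0..<p}. if x = 0 then 0 else 1)"
    by (intro sum.cong) (auto simp: Legendre_square dest: zdvd_imp_le)
  also have "\<dots> = (\<Sum>x\<in>{0..<p}. 1 - (if x = 0 then 1 else 0))"
    by (intro sum.cong) auto
  also have "\<dots> = p - 1"
    using p_gt_2 by (simp add: sum_subtractf)
  finally show ?thesis .
qed

lemma sum_Legendre_shift:
  "(\<Sum>x\<in>{0..<p}. Legendre x p * Legendre (x + d) p) = p * of_bool (p dvd d) - 1"
proof -
  define T where "T d = (\<Sum>x\<in>{0..<p}. Legendre x p * Legendre (x + d) p)" for d
  have T_dvd: "T d = p - 1" if "p dvd d" for d
    unfolding T_def sum_Legendre_square[symmetric]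
    using that by (intro sum.cong refl arg_cong2[where f = "(*)"] Legendre_cong)
      (auto simp: cong_iff_dvd_diff)
  have T_scale: "T d = T 1" if "\<not> p dvd d" for d
  proof -
    \<comment> \<open>Substituting \<open>d * x\<close> for \<open>x\<close> makes both factors
      divisible by \<open>d\<close>, so the square of \<open>Legendre d p\<close>, which is 1,
      splits off.\<close>
    have "T d = (\<Sum>x\<in>{0..<p}. Legendre (d * x + 0) p * Legendre (d * x + 0 + d) p)"
      unfolding T_def using that p_gt_2
      by (intro sum_residues_affine[symmetric])
        (auto simp: coprime_p_iff intro!: arg_cong2[where f = "(*)"] Legendre_cong cong_add)
    also have "\<dots> = (\<Sum>x\<in>{0..<p}. (Legendre d p * Legendre d p) * (Legendre x p * Legendre (x + 1) p))"
    proof (intro sum.cong refl)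
      fix x
      have "d * x + 0 + d = d * (x + 1)"
        by (simp add: distrib_left)
      then show "Legendre (d * x + 0) p * Legendre (d * x + 0 + d) p =
          (Legendre d p * Legendre d p) * (Legendre x p * Legendre (x + 1) p)"
        by (simp only: Legendre_mult add_0_right mult_ac)
    qed
    also have "\<dots> = T 1"
      using that by (simp add: Legendre_square T_def)
    finally show ?thesis .
  qed
  \<comment> \<open>All \<open>T d\<close> with \<open>p\<close> not dividing \<open>d\<close> coincide, and averaging over \<open>d\<close> determines them.\<close>
  have "0 = (\<Sum>d\<in>{0..<p}. T d)"
    unfolding T_def using sum_Legendre_affine[of 1] p_gt_2
    by (subst sum.swap) (simp add: add.commute flip: sum_distrib_left)
  also have "\<dots> = (\<Sum>d\<in>{0..<p}. T 1 + (if d = 0 then p - 1 - T 1 else 0))"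
    by (intro sum.cong) (auto simp: T_dvd intro!: T_scale dest: zdvd_imp_le)
  also have "\<dots> = (p - 1) * (T 1 + 1)"
    using p_gt_2 by (simp add: sum.distrib algebra_simps)
  finally have "T 1 = -1"
    using p_gt_2 by simp
  then show ?thesis
    using T_dvd[of d] T_scale[of d] by (auto simp: T_def)
qed

text \<open>The substitution \<open>x = n * t + a\<close> reduces this to the correlation with shift
  \<open>b - a\<close>.\<close>

lemma sum_Legendre_affine_pair:
  assumes "\<not> p dvd n"
  shows "(\<Sum>t\<in>{0..<p}. Legendre (a + n * t) p * Legendre (b + n * t) p) =
    p * of_bool [a = b] (mod p) - 1"
proof -
  let ?g = "\<lambda>x. Legendre x p * Legendre (x + (b - a)) p"
  have "(\<Sum>t\<in>{0..<p}. Legendre (a + n * t) p * Legendre (b + n * t) p) =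
      (\<Sum>t\<in>{0..<p}. ?g (n * t + a))"
    by (intro sum.cong) (simp_all add: algebra_simps)
  also have "\<dots> = (\<Sum>x\<in>{0..<p}. ?g x)"
    using assms p_gt_2 by (intro sum_residues_affine)
      (auto simp: coprime_p_iff intro!: arg_cong2[where f = "(*)"] Legendre_cong cong_add cong_diff)
  finally show ?thesis
    by (simp add: sum_Legendre_shift cong_iff_dvd_diff dvd_diff_commute)
qed

section \<open>The second moment of the family\<close>

lemma second_moment_family_E_double_sum:
  assumes "\<not> p dvd n" and "c = 4 * m + 1"
  shows "second_moment (family_E m n) p = p * (\<Sum>x\<in>{0..<p}. \<Sum>y\<in>{0..<p}.
    Legendre x p * Legendre y p * of_bool [4 * x\<^sup>2 + c * x = 4 * y\<^sup>2 + c * y] (mod p))"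
proof -
  let ?L = "\<lambda>a. Legendre a p" and ?q = "\<lambda>x. 4 * x\<^sup>2 + c * x"
  let ?I = "{0..<p}"
  have fact: "?L (poly (fibre (family_E m n) t) x) = ?L x * ?L (?q x + n * t)" for t x
    by (simp add: poly_fibre_family_E assms(2) flip: Legendre_mult)
      (simp add: algebra_simps power2_eq_square power3_eq_cube)
  have "second_moment (family_E m n) p =
      (\<Sum>t\<in>?I. \<Sum>x\<in>?I. \<Sum>y\<in>?I. (?L x * ?L y) * (?L (?q x + n * t) * ?L (?q y + n * t)))"
    unfolding second_moment_def trace_of_fibre_eq power2_minus fact
    by (simp add: power2_eq_square[of "sum _ _"] sum_product mult_ac)
  also have "\<dots> = (\<Sum>x\<in>?I. \<Sum>y\<in>?I. \<Sum>t\<in>?I.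
      (?L x * ?L y) * (?L (?q x + n * t) * ?L (?q y + n * t)))"
    by (subst sum.swap, intro sum.cong refl sum.swap)
  also have "\<dots> = (\<Sum>x\<in>?I. \<Sum>y\<in>?I.
      (?L x * ?L y) * (p * of_bool [?q x = ?q y] (mod p) - 1))"
    by (simp only: sum_distrib_left[symmetric] sum_Legendre_affine_pair[OF assms(1)])
  also have "\<dots> = p * (\<Sum>x\<in>?I. \<Sum>y\<in>?I. ?L x * ?L y * of_bool [?q x = ?q y] (mod p))
      - (\<Sum>x\<in>?I. \<Sum>y\<in>?I. ?L x * ?L y)"
    by (simp only: right_diff_distrib sum_subtractf sum_distrib_left mult_ac mult_1_left mult_1_right)
  \<comment> \<open>The -1 in every correlation contributes a product of two complete sums, so only
    the congruent pairs, with weight \<open>p\<close>, survive.\<close>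
  also have "(\<Sum>x\<in>?I. \<Sum>y\<in>?I. ?L x * ?L y) = 0"
    by (simp add: sum_Legendre flip: sum_product)
  finally show ?thesis by simp
qed

text \<open>The pairs \<open>y = x\<close> contribute \<open>p - 1\<close>, the pairs
  \<open>y = 2 * z - x\<close> contribute \<open>- Legendre (-1) p\<close>, and 1 is subtracted for
  the pair \<open>x = y = z\<close> counted twice.\<close>

lemma second_moment_family_E:
  assumes "\<not> p dvd n" and "\<not> p dvd 4 * m + 1"
  shows "second_moment (family_E m n) p = p * (p - 2 - Legendre (-1) p)"
proof -
  let ?L = "\<lambda>a. Legendre a p"
  let ?I = "{0..<p}"
  define c where "c = 4 * m + 1"
  have "coprime 8 p"
    using odd_p coprime_power_left_iff[of 2 3 p] by simp
  then obtain j where j: "[8 * j = 1] (mod p)"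
    using cong_solve_coprime_int by blast
  \<comment> \<open>\<open>z = - c / 8\<close> is the fixed point of the involution \<open>x \<mapsto> - x - c / 4\<close>.\<close>
  define z where "z = - c * j"
  have cz: "p dvd c + 8 * z"
  proof -
    have "c + 8 * z = c * (1 - 8 * j)"
      by (simp add: z_def algebra_simps)
    then show ?thesis
      using j by (simp add: cong_iff_dvd_diff dvd_diff_commute)
  qed
  \<comment> \<open>This is where \<open>\<not> p dvd 4 * m + 1\<close> enters: it makes the doubly
    counted term equal to 1 and the shift \<open>- 2 * z\<close> nonzero modulo
    \<open>p\<close>.\<close>
  have z_ndvd: "\<not> p dvd z"
    using cz assms(2) by (metis c_def dvd_add_left_iff dvd_mult)
  have dvd2: "p dvd 2 * a \<longleftrightarrow> p dvd a" for a
    using prime_p not_p_dvd_2 by (simp add: prime_dvd_mult_iff)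
  have not_dvd4: "\<not> p dvd 4"
    using dvd2[of 2] not_p_dvd_2 by simp
  have iff: "[4 * x\<^sup>2 + c * x = 4 * y\<^sup>2 + c * y] (mod p) \<longleftrightarrow>
      [y = x] (mod p) \<or> [y = 2 * z - x] (mod p)" for x y
  proof -
    \<comment> \<open>The difference is \<open>(x - y) * (4 * (x + y) + c)\<close>; modulo
      \<open>p\<close>, \<open>c\<close> may be replaced by \<open>- 8 * z\<close>.\<close>
    have "4 * x\<^sup>2 + c * x - (4 * y\<^sup>2 + c * y) =
        (x - y) * (4 * (y - (2 * z - x))) + (c + 8 * z) * (x - y)"
      by (simp add: algebra_simps power2_eq_square)
    then have "p dvd 4 * x\<^sup>2 + c * x - (4 * y\<^sup>2 + c * y) \<longleftrightarrow>
        p dvd (x - y) * (4 * (y - (2 * z - x)))"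
      using cz by (simp add: dvd_add_left_iff)
    then show ?thesis
      by (simp only: prime_dvd_mult_iff[OF prime_p] not_dvd4 simp_thms
          cong_iff_dvd_diff dvd_diff_commute[of p x y])
  qed
  have both: "[y = x] (mod p) \<and> [y = 2 * z - x] (mod p) \<longleftrightarrow>
      [y = x] (mod p) \<and> [x = z] (mod p)" for x y
  proof -
    have "[x = 2 * z - x] (mod p) \<longleftrightarrow> p dvd 2 * (x - z)"
      by (simp add: cong_iff_dvd_diff algebra_simps)
    also have "\<dots> \<longleftrightarrow> [x = z] (mod p)"
      by (simp only: dvd2 cong_iff_dvd_diff)
    finally show ?thesis
      by (auto simp: cong_def)
  qed
  \<comment> \<open>Inclusion-exclusion: the two solutions for \<open>y\<close> coincide only at the
    fixed point \<open>x = z\<close>.\<close>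
  have ind: "(of_bool [4 * x\<^sup>2 + c * x = 4 * y\<^sup>2 + c * y] (mod p) :: int) =
      of_bool [y = x] (mod p) + of_bool [y = 2 * z - x] (mod p)
      - of_bool [y = x] (mod p) * of_bool [x = z] (mod p)" for x y
    using both[of y x] unfolding iff by auto
  have pick: "(\<Sum>y\<in>?I. ?L y * of_bool [y = w] (mod p)) = ?L w" for w
    using p_gt_2 by (intro sum_residues_delta) (auto simp: Legendre_cong)
  have inner: "(\<Sum>y\<in>?I. ?L x * ?L y * of_bool [4 * x\<^sup>2 + c * x = 4 * y\<^sup>2 + c * y] (mod p)) =
      ?L x * ?L x + ?L (-1) * (?L x * ?L (x + - 2 * z)) - ?L x * ?L x * of_bool [x = z] (mod p)" for x
  proof -
    have "(\<Sum>y\<in>?I. ?L x * ?L y * of_bool [4 * x\<^sup>2 + c * x = 4 * y\<^sup>2 + c * y] (mod p)) =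
        ?L x * (\<Sum>y\<in>?I. ?L y * of_bool [y = x] (mod p))
        + ?L x * (\<Sum>y\<in>?I. ?L y * of_bool [y = 2 * z - x] (mod p))
        - ?L x * of_bool [x = z] (mod p) * (\<Sum>y\<in>?I. ?L y * of_bool [y = x] (mod p))"
      unfolding ind sum_distrib_left sum.distrib[symmetric] sum_subtractf[symmetric]
      by (intro sum.cong refl) (simp only: algebra_simps)
    also have "\<dots> = ?L x * ?L x + ?L x * ?L (2 * z - x) - ?L x * ?L x * of_bool [x = z] (mod p)"
      unfolding pick by (simp only: mult_ac)
    \<comment> \<open>Pulling out the sign leaves a correlation with shift
      \<open>- 2 * z\<close>.\<close>
    also have "?L (2 * z - x) = ?L (-1) * ?L (x + - 2 * z)"
      by (simp flip: Legendre_mult)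
    finally show ?thesis
      by (simp add: mult_ac)
  qed
  have "(\<Sum>x\<in>?I. ?L x * ?L x * of_bool [x = z] (mod p)) = ?L z * ?L z"
    using p_gt_2 by (intro sum_residues_delta) (auto simp: Legendre_cong)
  also have "\<dots> = 1"
    using z_ndvd by (simp add: Legendre_square)
  finally have "(\<Sum>x\<in>?I. \<Sum>y\<in>?I.
      ?L x * ?L y * of_bool [4 * x\<^sup>2 + c * x = 4 * y\<^sup>2 + c * y] (mod p)) =
      p - 1 + ?L (-1) * (p * of_bool (p dvd - 2 * z) - 1) - 1"
    unfolding inner sum.distrib sum_subtractf sum_Legendre_square
    by (simp only: sum_distrib_left[symmetric] sum_Legendre_shift)
  moreover have "\<not> p dvd - 2 * z"
    using z_ndvd dvd2[of z] by simp
  ultimately show ?thesis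
    by (simp add: second_moment_family_E_double_sum[OF assms(1) c_def])
qed

end

text \<open>The primes dividing \<open>n\<close> or \<open>4 * m + 1\<close> are genuine exceptions.
  If \<open>p\<close> divides \<open>n\<close>, all fibres agree modulo \<open>p\<close> and the
  moment is 0 or \<open>p\<close>; if \<open>p\<close> divides only \<open>4 * m + 1\<close>, it is
  \<open>p * (p - 1) * (1 + Legendre (-1) p)\<close>.\<close>

theorem lemma2p5:
  fixes p m n :: int
  assumes "prime p" and "odd p"
    and "\<not> p dvd n" and "\<not> p dvd 4 * m + 1"
  shows "((\<exists>k. p = 4 * k + 1) \<longrightarrow> second_moment (family_E m n) p = p ^ 2 - 3 * p) \<and>
         ((\<exists>k. p = 4 * k + 3) \<longrightarrow> second_moment (family_E m n) p = p ^ 2 - p)"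
proof (intro conjI impI; elim exE)
  have p: "p > 2"
    using assms(1,2) by (rule p_gt_2)
  note moment = second_moment_family_E[OF assms] Legendre_minus_1[OF assms(1,2)]
  fix k
  {
    assume k: "p = 4 * k + 1"
    \<comment> \<open>The parity of this exponent decides \<open>Legendre (-1) p\<close>: here it is
      1, giving \<open>p * (p - 3)\<close>; in the other case it is -1, giving
      \<open>p * (p - 1)\<close>.\<close>
    then have "(p - 1) div 2 = 2 * k" "k \<ge> 0"
      using p by auto
    then show "second_moment (family_E m n) p = p ^ 2 - 3 * p"
      using moment by (simp add: nat_mult_distrib power2_eq_square algebra_simps)
  next
    assume k: "p = 4 * k + 3"
    then have "(p - 1) div 2 = 2 * k + 1" "k \<ge> 0"
      using p by auto
    then show "second_moment (family_E m n) p = p ^ 2 - p"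
      using moment by (simp add: nat_add_distrib nat_mult_distrib power2_eq_square algebra_simps)
  }
qed

end
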